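(* Let $\{\alpha_n\}_{n\in\mathbb{N}}$ be a sequence in $\mathrm{M}^+(\Omega)$ such that $\alpha_n\to\alpha$ strongly in $\mathrm{M}(\Omega)$ for some $\alpha$. Then every sequence $\{\mu_n\}$ in $$\mathbf{H}=\bigcup_{n=1}^\infty \mathbf{K}(\alpha_n)$$ admits a subsequence that converges in the narrow topology on $\mathrm{M}(\Omega)^N$ to some $\mu\in\mathrm{M}(\Omega)^N$. Further, $\mu$ belongs either to $\mathbf{K}(\alpha_i)$ for some $i\in\mathbb{N}$, or to the narrow closure of $\bigcup_{n=j}^\infty\mathbf{K}(\alpha_n)$ for each $j\in\mathbb{N}$.
   Context: $\Omega$ is an open subset of $\mathbb{R}^M$, $M,N\in\mathbb{N}$. $\mathrm{M}(\Omega)$ and $\mathrm{M}(\Omega)^N$ are the spaces of (finite) real-valued, respectively $\mathbb{R}^N$-valued, measures on the Borel $\sigma$-algebra $\mathcal{B}(\Omega)$, and $\mathrm{M}^+(\Omega)\subset\mathrm{M}(\Omega)$ is the set of non-negative ones. $|\mu|\in\mathrm{M}^+(\Omega)$ is the total variation measure of $\mu\in\mathrm{M}(\Omega)^N$ (with respect to the Euclidean norm), and $\|\mu\|_{\mathrm{M}(\Omega)^N}=|\mu|(\Omega)$; strong convergence is convergence in this norm. For $\mu,\sigma\in\mathrm{M}(\Omega)$, $\mu\le\sigma$ means $\sigma-\mu\in\mathrm{M}^+(\Omega)$, i.e. $\mu(B)\le\sigma(B)$ for all $B\in\mathcal{B}(\Omega)$. For $\alpha\in\mathrm{M}^+(\Omega)$,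 $\mathbf{K}(\alpha)=\{\mu\in\mathrm{M}(\Omega)^N:|\mu|\le\alpha\}$. A sequence $\mu_n$ converges narrowly to $\mu$ in $\mathrm{M}(\Omega)^N$ if $\int_\Omega\phi\cdot d\mu_n\to\int_\Omega\phi\cdot d\mu$ for all $\phi\in C_b(\Omega)^N$, where $C_b(\Omega)$ is the set of bounded continuous functions on $\Omega$ and $\int_\Omega\phi\cdot d\mu=\sum_{i=1}^N\int_\Omega\phi_i\,d\mu_i$; the narrow topology is the corresponding topology on $\mathrm{M}(\Omega)^N$ induced by these functionals, and the narrow closure is the closure in it. *)

theory Defs
  imports "HOL-Analysis.Analysis"
begin

abbreviation borel_on :: "'a::topological_space set \<Rightarrow> 'a set set" where
  "borel_on \<Omega> \<equiv> sets (restrict_space borel \<Omega>)"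

text \<open>
  A measure with values in \<open>'b\<close> (\<open>real\<close>, or \<open>real ^ 'n\<close> with its Euclidean norm) is a
  countably additive set function on the Borel sets of \<open>\<Omega>\<close>.  Set functions are total in HOL; the
  value on all other sets is fixed to be \<open>0\<close>, so that equality of measures is equality of
  functions.  The condition on a constant sequence of empty sets yields \<open>\<mu> {} = 0\<close>.
\<close>

definition vmeasures :: "'a::topological_space set \<Rightarrow> ('a set \<Rightarrow> 'b::real_normed_vector) set" where
  "vmeasures \<Omega> = {\<mu>.
     (\<forall>A. range A \<subseteq> borel_on \<Omega> \<longrightarrow> disjoint_family A \<longrightarrow>
        (\<lambda>i::nat. \<mu> (A i)) sums \<mu> (\<Union>i. A i)) \<and>
     (\<forall>B. B \<notin> borel_on \<Omega> \<longrightarrow> \<mu> B = 0)}"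

definition pos_measures :: "'a::topological_space set \<Rightarrow> ('a set \<Rightarrow> real) set" where
  "pos_measures \<Omega> = {\<mu> \<in> vmeasures \<Omega>. \<forall>B\<in>borel_on \<Omega>. 0 \<le> \<mu> B}"

text \<open>
  The total variation measure: the supremum over countable Borel partitions.  Its values are taken in
  \<open>ennreal\<close>, so that the supremum is always meaningful; it is finite
  for every \<open>\<mu> \<in> vmeasures \<Omega>\<close> with values in a finite-dimensional space.
\<close>

definition total_variation ::
    "'a::topological_space set \<Rightarrow> ('a set \<Rightarrow> 'b::real_normed_vector) \<Rightarrow> 'a set \<Rightarrow> ennreal" where
  "total_variation \<Omega> \<mu> B =
     (SUP A \<in> {A :: nat \<Rightarrow> 'a set. range A \<subseteq> borel_on \<Omega> \<and> disjoint_family A \<and> (\<Union>i. A i) = B}.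
        \<Sum>i. ennreal (norm (\<mu> (A i))))"

definition tv_norm :: "'a::topological_space set \<Rightarrow> ('a set \<Rightarrow> 'b::real_normed_vector) \<Rightarrow> ennreal" where
  "tv_norm \<Omega> \<mu> = total_variation \<Omega> \<mu> \<Omega>"

definition converges_strongly ::
    "'a::topological_space set \<Rightarrow> (nat \<Rightarrow> 'a set \<Rightarrow> 'b::real_normed_vector) \<Rightarrow> ('a set \<Rightarrow> 'b) \<Rightarrow> bool" where
  "converges_strongly \<Omega> \<mu> \<nu> \<longleftrightarrow> (\<lambda>n. tv_norm \<Omega> (\<lambda>B. \<mu> n B - \<nu> B)) \<longlonglongrightarrow> 0"

definition K_set ::
    "'a::topological_space set \<Rightarrow> ('a set \<Rightarrow> real) \<Rightarrow> ('a set \<Rightarrow> 'b::real_normed_vector) set" where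
  "K_set \<Omega> \<alpha> = {\<mu> \<in> vmeasures \<Omega>. \<forall>B\<in>borel_on \<Omega>. total_variation \<Omega> \<mu> B \<le> ennreal (\<alpha> B)}"

text \<open>
  Integration against a real-valued measure \<open>\<nu>\<close> uses its Jordan decomposition.  The positive part
  is \<open>B \<mapsto> sup {\<nu> A | A \<subseteq> B Borel}\<close>, the negative part is the positive part of \<open>-\<nu>\<close>.  The
  truncation of negative values by \<open>ennreal\<close> does not affect the supremum, since \<open>\<nu> {} = 0\<close>.
\<close>

definition pos_part :: "'a::topological_space set \<Rightarrow> ('a set \<Rightarrow> real) \<Rightarrow> 'a measure" where
  "pos_part \<Omega> \<nu> =
     measure_of \<Omega> (borel_on \<Omega>) (\<lambda>B. SUP A \<in> {A \<in> borel_on \<Omega>. A \<subseteq> B}. ennreal (\<nu> A))"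

lemma vmeasures_sums:
  assumes "\<nu> \<in> vmeasures \<Omega>" "range A \<subseteq> borel_on \<Omega>" "disjoint_family A"
  shows "(\<lambda>i::nat. \<nu> (A i)) sums \<nu> (\<Union>i. A i)"
  using assms by (simp add: vmeasures_def)

lemma vmeasures_empty:
  assumes "\<nu> \<in> vmeasures \<Omega>"
  shows "\<nu> {} = 0"
proof -
  have "(\<lambda>i::nat. \<nu> ((\<lambda>_. {}) i)) sums \<nu> (\<Union>i::nat. (\<lambda>_. {}) i)"
    by (rule vmeasures_sums[OF assms]) (auto simp: disjoint_family_on_def)
  then have "(\<lambda>i::nat. \<nu> {}) \<longlonglongrightarrow> 0"
    by (auto dest: sums_summable summable_LIMSEQ_zero)
  then show ?thesis
    by (simp add: LIMSEQ_const_iff)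
qed

lemma vmeasures_Un:
  assumes \<nu>: "\<nu> \<in> vmeasures \<Omega>" and AB: "A \<in> borel_on \<Omega>" "B \<in> borel_on \<Omega>" "A \<inter> B = {}"
  shows "\<nu> (A \<union> B) = \<nu> A + \<nu> B"
proof -
  have "range (binaryset A B) \<subseteq> borel_on \<Omega>" "disjoint_family (binaryset A B)"
    using AB by (auto simp: range_binaryset_eq disjoint_family_on_def binaryset_def)
  then have "(\<lambda>i. \<nu> (binaryset A B i)) sums \<nu> (A \<union> B)"
    using vmeasures_sums[OF \<nu>, of "binaryset A B"] by (simp only: UN_binaryset_eq)
  moreover have "(\<lambda>i. \<nu> (binaryset A B i)) sums (\<nu> A + \<nu> B)"
    by (rule binaryset_sums) (rule vmeasures_empty[OF \<nu>])
  ultimately show ?thesis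
    by (rule sums_unique2)
qed

lemma emeasure_pos_part:
  assumes \<nu>: "\<nu> \<in> vmeasures \<Omega>" and B: "B \<in> borel_on \<Omega>"
  shows "emeasure (pos_part \<Omega> \<nu>) B = (SUP A \<in> {A \<in> borel_on \<Omega>. A \<subseteq> B}. ennreal (\<nu> A))"
    (is "_ = ?P B")
proof -
  have sp: "space (restrict_space borel \<Omega>) = \<Omega>" by (simp add: space_restrict_space)
  have sa: "sigma_algebra \<Omega> (borel_on \<Omega>)"
    using sets.sigma_algebra_axioms[of "restrict_space borel \<Omega>"] by (simp only: sp)
  have empty: "\<nu> {} = 0" by (rule vmeasures_empty[OF \<nu>])
  have fin_add: "?P C + ?P D \<le> ?P (C \<union> D)"
    if CD: "C \<in> borel_on \<Omega>" "D \<in> borel_on \<Omega>" "C \<inter> D = {}" for C D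
  proof -
    have ne: "{A \<in> borel_on \<Omega>. A \<subseteq> X} \<noteq> {}" for X :: "'a set" by blast
    have *: "ennreal (\<nu> A) + ennreal (\<nu> A') \<le> ?P (C \<union> D)"
      if A: "A \<in> borel_on \<Omega>" "A \<subseteq> C" "A' \<in> borel_on \<Omega>" "A' \<subseteq> D" for A A'
    proof -
      have up: "ennreal (\<nu> X) \<le> ?P (C \<union> D)" if "X \<in> borel_on \<Omega>" "X \<subseteq> C \<union> D" for X
        using that by (intro SUP_upper) auto
      consider "\<nu> A \<le> 0" | "\<nu> A' \<le> 0" | "0 \<le> \<nu> A" "0 \<le> \<nu> A'" by linarith
      then show ?thesis
      proof cases
        case 1
        then show ?thesis using up[of A'] A by (auto simp: ennreal_neg)
      next
        case 2
        then show ?thesis using up[of A] A by (auto simp: ennreal_neg)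
      next
        case 3
        have "\<nu> (A \<union> A') = \<nu> A + \<nu> A'"
          using A CD(3) by (intro vmeasures_Un[OF \<nu>]) auto
        with 3 have "ennreal (\<nu> A) + ennreal (\<nu> A') = ennreal (\<nu> (A \<union> A'))" by simp
        also have "\<dots> \<le> ?P (C \<union> D)" using A by (intro up) auto
        finally show ?thesis .
      qed
    qed
    have "?P C + ?P D = (SUP A \<in> {A \<in> borel_on \<Omega>. A \<subseteq> C}. ennreal (\<nu> A) + ?P D)"
      by (rule ennreal_SUP_add_left[OF ne, symmetric])
    also have "\<dots> = (SUP A \<in> {A \<in> borel_on \<Omega>. A \<subseteq> C}. SUP A' \<in> {A \<in> borel_on \<Omega>. A \<subseteq> D}.
        ennreal (\<nu> A) + ennreal (\<nu> A'))"
      by (intro SUP_cong refl) (rule ennreal_SUP_add_right[OF ne])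
    also have "\<dots> \<le> ?P (C \<union> D)"
      by (intro SUP_least *) auto
    finally show ?thesis .
  qed
  have ca: "countably_additive (borel_on \<Omega>) ?P"
    unfolding countably_additive_def
  proof (intro allI impI antisym)
    fix A :: "nat \<Rightarrow> 'a set"
    assume A: "range A \<subseteq> borel_on \<Omega>" "disjoint_family A" "(\<Union>i. A i) \<in> borel_on \<Omega>"
    show "(\<Sum>i. ?P (A i)) \<le> ?P (\<Union>i. A i)"
    proof (rule suminf_le_const)
      fix n
      have "(\<Sum>i<n. ?P (A i)) \<le> ?P (\<Union>i<n. A i)"
      proof (induction n)
        case (Suc n)
        have "A i \<inter> A n = {}" if "i < n" for i
          using that by (intro disjoint_family_onD[OF A(2)]) auto
        then have "(\<Union>i<n. A i) \<inter> A n = {}" by blast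
        moreover have "(\<Union>i<n. A i) \<in> borel_on \<Omega>" "A n \<in> borel_on \<Omega>"
          using A(1) by auto
        ultimately have "?P (\<Union>i<n. A i) + ?P (A n) \<le> ?P ((\<Union>i<n. A i) \<union> A n)"
          by (intro fin_add)
        moreover have "(\<Union>i<n. A i) \<union> A n = (\<Union>i<Suc n. A i)"
          by (auto simp: less_Suc_eq)
        ultimately have "?P (\<Union>i<n. A i) + ?P (A n) \<le> ?P (\<Union>i<Suc n. A i)"
          by (simp only:)
        then show ?case
          unfolding sum.lessThan_Suc by (rule order_trans[OF add_right_mono[OF Suc.IH]])
      qed simp
      also have "?P (\<Union>i<n. A i) \<le> ?P (\<Union>i. A i)"
        by (intro SUP_subset_mono) auto
      finally show "(\<Sum>i<n. ?P (A i)) \<le> ?P (\<Union>i. A i)" .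
    qed simp
    show "?P (\<Union>i. A i) \<le> (\<Sum>i. ?P (A i))"
    proof (rule SUP_least)
      fix C assume "C \<in> {C \<in> borel_on \<Omega>. C \<subseteq> (\<Union>i. A i)}"
      then have C: "C \<in> borel_on \<Omega>" "C \<subseteq> (\<Union>i. A i)" by auto
      have "range (\<lambda>i. C \<inter> A i) \<subseteq> borel_on \<Omega>" using A(1) C(1) by auto
      moreover have "disjoint_family (\<lambda>i. C \<inter> A i)"
        using A(2) by (auto simp: disjoint_family_on_def)
      ultimately have "(\<lambda>i. \<nu> (C \<inter> A i)) sums \<nu> (\<Union>i. C \<inter> A i)"
        by (rule vmeasures_sums[OF \<nu>])
      moreover have "(\<Union>i. C \<inter> A i) = C" using C(2) by auto
      ultimately have "(\<lambda>n. \<Sum>i<n. \<nu> (C \<inter> A i)) \<longlonglongrightarrow> \<nu> C" by (simp add: sums_def)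
      then have "(\<lambda>n. ennreal (\<Sum>i<n. \<nu> (C \<inter> A i))) \<longlonglongrightarrow> ennreal (\<nu> C)"
        by (rule tendsto_ennrealI)
      moreover have "ennreal (\<Sum>i<n. \<nu> (C \<inter> A i)) \<le> (\<Sum>i. ?P (A i))" for n
      proof -
        have "ennreal (\<Sum>i<n. \<nu> (C \<inter> A i)) \<le> ennreal (\<Sum>i<n. max 0 (\<nu> (C \<inter> A i)))"
          by (intro ennreal_leI sum_mono) auto
        also have "\<dots> = (\<Sum>i<n. ennreal (max 0 (\<nu> (C \<inter> A i))))"
          by (rule sum_ennreal[symmetric]) auto
        also have "\<dots> \<le> (\<Sum>i<n. ?P (A i))"
        proof (rule sum_mono)
          fix i
          have "ennreal (max 0 (\<nu> (C \<inter> A i))) = ennreal (\<nu> (C \<inter> A i))"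
            by (simp add: max_def ennreal_neg)
          also have "\<dots> \<le> ?P (A i)"
            using A(1) C(1) by (intro SUP_upper) auto
          finally show "ennreal (max 0 (\<nu> (C \<inter> A i))) \<le> ?P (A i)" .
        qed
        also have "\<dots> \<le> (\<Sum>i. ?P (A i))" by (rule sum_le_suminf) auto
        finally show ?thesis .
      qed
      ultimately show "ennreal (\<nu> C) \<le> (\<Sum>i. ?P (A i))"
        by (intro LIMSEQ_le_const2) auto
    qed
  qed
  have "positive (borel_on \<Omega>) ?P"
  proof -
    have "{A \<in> borel_on \<Omega>. A \<subseteq> {}} = {{}}" by auto
    then show ?thesis by (simp add: positive_def empty)
  qed
  then show ?thesis
    unfolding pos_part_def using sa ca B by (intro emeasure_measure_of_sigma) auto
qed

definition signed_integral :: "'a::topological_space set \<Rightarrow> ('a set \<Rightarrow> real) \<Rightarrow> ('a \<Rightarrow> real) \<Rightarrow> real" where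
  "signed_integral \<Omega> \<nu> f =
     (LINT x|pos_part \<Omega> \<nu>. f x) - (LINT x|pos_part \<Omega> (\<lambda>B. - \<nu> B). f x)"

definition vec_integral ::
    "'a::topological_space set \<Rightarrow> ('a set \<Rightarrow> real ^ 'n) \<Rightarrow> ('a \<Rightarrow> real ^ 'n) \<Rightarrow> real" where
  "vec_integral \<Omega> \<mu> \<phi> = (\<Sum>i\<in>UNIV. signed_integral \<Omega> (\<lambda>B. \<mu> B $ i) (\<lambda>x. \<phi> x $ i))"

definition bounded_continuous_on ::
    "'a::topological_space set \<Rightarrow> ('a \<Rightarrow> 'b::real_normed_vector) set" where
  "bounded_continuous_on \<Omega> = {\<phi>. continuous_on \<Omega> \<phi> \<and> bounded (\<phi> ` \<Omega>)}"

text \<open>The narrow topology, with carrier \<open>vmeasures \<Omega>\<close>: the initial topology of the functionals.\<close>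

definition narrow_topology :: "'a::topological_space set \<Rightarrow> ('a set \<Rightarrow> real ^ 'n) topology" where
  "narrow_topology \<Omega> = topology_generated_by
     {{\<mu> \<in> vmeasures \<Omega>. vec_integral \<Omega> \<mu> \<phi> \<in> U} | \<phi> U.
        \<phi> \<in> bounded_continuous_on \<Omega> \<and> open U}"

lemma topspace_narrow_topology: "topspace (narrow_topology \<Omega>) = vmeasures \<Omega>"
proof -
  have "vmeasures \<Omega> \<in> {{\<mu> \<in> vmeasures \<Omega>. vec_integral \<Omega> \<mu> \<phi> \<in> U} | \<phi> U.
        \<phi> \<in> bounded_continuous_on \<Omega> \<and> open (U :: real set)}"
    by (rule CollectI, rule exI[of _ "\<lambda>_. 0 :: real ^ 'n"], rule exI[of _ UNIV])
       (auto simp: bounded_continuous_on_def image_constant_conv)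
  then show ?thesis
    by (auto simp: narrow_topology_def topology_generated_by_topspace)
qed

lemma limitin_narrow_topology:
  assumes "\<And>n. \<mu> n \<in> vmeasures \<Omega>" "\<nu> \<in> vmeasures \<Omega>"
  shows "limitin (narrow_topology \<Omega>) \<mu> \<nu> sequentially \<longleftrightarrow>
    (\<forall>\<phi>\<in>bounded_continuous_on \<Omega>. (\<lambda>n. vec_integral \<Omega> (\<mu> n) \<phi>) \<longlonglongrightarrow> vec_integral \<Omega> \<nu> \<phi>)"
proof
  assume L: "limitin (narrow_topology \<Omega>) \<mu> \<nu> sequentially"
  show "\<forall>\<phi>\<in>bounded_continuous_on \<Omega>. (\<lambda>n. vec_integral \<Omega> (\<mu> n) \<phi>) \<longlonglongrightarrow> vec_integral \<Omega> \<nu> \<phi>"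
  proof (intro ballI topological_tendstoI)
    fix \<phi> :: "'a \<Rightarrow> real ^ 'b" and U :: "real set"
    assume *: "\<phi> \<in> bounded_continuous_on \<Omega>" "open U" "vec_integral \<Omega> \<nu> \<phi> \<in> U"
    then have "openin (narrow_topology \<Omega>) {\<mu> \<in> vmeasures \<Omega>. vec_integral \<Omega> \<mu> \<phi> \<in> U}"
      unfolding narrow_topology_def by (intro topology_generated_by_Basis) auto
    with L * assms(2) have "\<forall>\<^sub>F n in sequentially. \<mu> n \<in> {\<mu> \<in> vmeasures \<Omega>. vec_integral \<Omega> \<mu> \<phi> \<in> U}"
      unfolding limitin_def by blast
    then show "\<forall>\<^sub>F n in sequentially. vec_integral \<Omega> (\<mu> n) \<phi> \<in> U"
      by (rule eventually_mono) auto
  qed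
next
  assume R: "\<forall>\<phi>\<in>bounded_continuous_on \<Omega>. (\<lambda>n. vec_integral \<Omega> (\<mu> n) \<phi>) \<longlonglongrightarrow> vec_integral \<Omega> \<nu> \<phi>"
  have "\<nu> \<in> W \<longrightarrow> (\<forall>\<^sub>F n in sequentially. \<mu> n \<in> W)"
    if "generate_topology_on {{\<mu> \<in> vmeasures \<Omega>. vec_integral \<Omega> \<mu> \<phi> \<in> U} | \<phi> U.
        \<phi> \<in> bounded_continuous_on \<Omega> \<and> open U} W" for W
    using that
  proof induction
    case (Int a b)
    then show ?case by (auto intro: eventually_conj)
  next
    case (UN K)
    show ?case
    proof
      assume "\<nu> \<in> \<Union>K"
      then obtain X where "X \<in> K" "\<nu> \<in> X" by blast
      with UN.IH have "\<forall>\<^sub>F n in sequentially. \<mu> n \<in> X" by blast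
      then show "\<forall>\<^sub>F n in sequentially. \<mu> n \<in> \<Union>K"
        by (rule eventually_mono) (use \<open>X \<in> K\<close> in blast)
    qed
  next
    case (Basis s)
    then obtain \<phi> U where "s = {\<mu> \<in> vmeasures \<Omega>. vec_integral \<Omega> \<mu> \<phi> \<in> U}"
      "\<phi> \<in> bounded_continuous_on \<Omega>" "open U" by blast
    with R assms(1) show ?case by (auto dest: topological_tendstoD)
  qed auto
  then show "limitin (narrow_topology \<Omega>) \<mu> \<nu> sequentially"
    using assms(2) unfolding limitin_def topspace_narrow_topology
    by (auto simp: narrow_topology_def openin_topology_generated_by_iff)
qed

end

theory Submission
  imports Defs
begin

text \<open>
  Narrow convergence is obtained from the stronger setwise convergence, so neither Prokhorov's theorem
  nor the Riesz representation theorem is needed.  Suppose \<open>|\<mu>\<^sub>k| \<le> \<beta>\<^sub>k\<close> and \<open>\<beta>\<^sub>k \<rightarrow> \<alpha>\<close> on every Borel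
  set.  By a diagonal argument a subsequence of \<open>\<mu>\<^sub>k\<close> converges on all finite unions of sets from a
  countable base.  Outer regularity of \<open>\<alpha>\<close> provides, for each Borel set \<open>B\<close>, such a finite union \<open>W\<close>
  with \<open>\<alpha> (B \<triangle> W)\<close> small; since \<open>|\<mu>\<^sub>k B - \<mu>\<^sub>k W| \<le> \<beta>\<^sub>k (B \<triangle> W)\<close>, the subsequence is Cauchy on \<open>B\<close>.
  The setwise limit is dominated by \<open>\<alpha>\<close>, hence countably additive.

  If \<open>\<mu>\<^sub>k \<in> K (\<alpha>\<^sub>i)\<close> with a fixed \<open>i\<close> for infinitely many \<open>k\<close>, this applies to the constant sequence
  \<open>\<alpha>\<^sub>i\<close>; otherwise the index of \<open>\<mu>\<^sub>k\<close> tends to infinity and it applies with the strong limit of the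
  \<open>\<alpha>\<^sub>n\<close>.
\<close>

section \<open>Finite additivity, total variation and domination by a positive measure\<close>

lemma Omega_in_borel_on [simp]: "\<Omega> \<in> borel_on \<Omega>"
  using sets.top[of "restrict_space borel \<Omega>"] by (simp add: space_restrict_space)

lemma vmeasuresI:
  assumes "\<And>A. range A \<subseteq> borel_on \<Omega> \<Longrightarrow> disjoint_family A \<Longrightarrow> (\<lambda>i::nat. \<nu> (A i)) sums \<nu> (\<Union>i. A i)"
    and "\<And>B. B \<notin> borel_on \<Omega> \<Longrightarrow> \<nu> B = 0"
  shows "\<nu> \<in> vmeasures \<Omega>"
  unfolding vmeasures_def by (intro CollectI conjI allI impI assms)

lemma vmeasures_Diff:
  assumes "\<nu> \<in> vmeasures \<Omega>" "A \<in> borel_on \<Omega>" "B \<in> borel_on \<Omega>" "B \<subseteq> A"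
  shows "\<nu> (A - B) = \<nu> A - \<nu> B"
proof -
  have "\<nu> (B \<union> (A - B)) = \<nu> B + \<nu> (A - B)"
    using assms by (intro vmeasures_Un) auto
  moreover have "B \<union> (A - B) = A" using assms(4) by blast
  ultimately show ?thesis by simp
qed

lemma vmeasures_outside: "\<nu> \<in> vmeasures \<Omega> \<Longrightarrow> B \<notin> borel_on \<Omega> \<Longrightarrow> \<nu> B = 0"
  unfolding vmeasures_def by blast

lemma pos_measures_vmeasures: "\<alpha> \<in> pos_measures \<Omega> \<Longrightarrow> \<alpha> \<in> vmeasures \<Omega>"
  unfolding pos_measures_def by blast

lemma pos_measures_nonneg: "\<alpha> \<in> pos_measures \<Omega> \<Longrightarrow> 0 \<le> \<alpha> B"
  unfolding pos_measures_def using vmeasures_outside[of \<alpha> \<Omega> B] by fastforce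

lemma pos_measures_mono:
  assumes "\<alpha> \<in> pos_measures \<Omega>" "A \<in> borel_on \<Omega>" "B \<in> borel_on \<Omega>" "A \<subseteq> B"
  shows "\<alpha> A \<le> \<alpha> B"
  using vmeasures_Diff[OF pos_measures_vmeasures[OF assms(1)] assms(3,2,4)]
    pos_measures_nonneg[OF assms(1), of "B - A"] by linarith

text \<open>The supremum is tested with the partition of \<open>B\<close> into \<open>A\<close>,
  \<open>B - A\<close> and empty sets, and only the first term of the sum is kept. Since
  \<open>\<mu>\<close> is an arbitrary set function, the bound also applies to the differences that
  occur in \<open>converges_strongly\<close>.\<close>

lemma norm_le_total_variation:
  assumes "A \<in> borel_on \<Omega>" "B \<in> borel_on \<Omega>" "A \<subseteq> B"
  shows "ennreal (norm (\<mu> A)) \<le> total_variation \<Omega> \<mu> B"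
proof -
  define P :: "nat \<Rightarrow> 'a set" where "P i = (if i = 0 then A else if i = 1 then B - A else {})" for i
  have "ennreal (norm (\<mu> A)) = (\<Sum>i\<in>{0}. ennreal (norm (\<mu> (P i))))"
    by (simp add: P_def)
  also have "\<dots> \<le> (\<Sum>i. ennreal (norm (\<mu> (P i))))"
    by (rule sum_le_suminf) simp_all
  also have "\<dots> \<le> total_variation \<Omega> \<mu> B"
    unfolding total_variation_def
  proof (rule SUP_upper, intro CollectI conjI)
    show "range P \<subseteq> borel_on \<Omega>" using assms(1,2) by (simp add: P_def image_subset_iff)
    show "disjoint_family P" by (auto simp: P_def disjoint_family_on_def)
    show "(\<Union>i. P i) = B"
    proof
      show "(\<Union>i. P i) \<subseteq> B" using assms(3) by (auto simp: P_def split: if_splits)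
      have "B \<subseteq> P 0 \<union> P 1" by (auto simp: P_def)
      then show "B \<subseteq> (\<Union>i. P i)" by blast
    qed
  qed
  finally show ?thesis .
qed

text \<open>Each partition sum is dominated term by term by the corresponding sum for
  \<open>\<alpha>\<close>, which countable additivity collapses to the value of
  \<open>\<alpha>\<close> on the union.\<close>

lemma total_variation_le:
  assumes "\<alpha> \<in> pos_measures \<Omega>" "\<And>A. A \<in> borel_on \<Omega> \<Longrightarrow> norm (\<mu> A) \<le> \<alpha> A"
  shows "total_variation \<Omega> \<mu> B \<le> ennreal (\<alpha> B)"
  unfolding total_variation_def
proof (rule SUP_least, clarify)
  fix A :: "nat \<Rightarrow> 'a set" assume A: "range A \<subseteq> borel_on \<Omega>" "disjoint_family A" "B = (\<Union>i. A i)"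
  have "(\<Sum>i. ennreal (norm (\<mu> (A i)))) \<le> (\<Sum>i. ennreal (\<alpha> (A i)))"
    using A(1) by (intro suminf_le ennreal_leI assms(2)) auto
  also have "(\<lambda>i. \<alpha> (A i)) sums \<alpha> (\<Union>i. A i)"
    using assms(1) A by (intro vmeasures_sums) (auto simp: pos_measures_def)
  then have "(\<Sum>i. ennreal (\<alpha> (A i))) = ennreal (\<alpha> (\<Union>i. A i))"
    using pos_measures_nonneg[OF assms(1)] by (intro suminf_ennreal_eq)
  finally show "(\<Sum>i. ennreal (norm (\<mu> (A i)))) \<le> ennreal (\<alpha> (\<Union>i. A i))" .
qed

text \<open>Trades the supremum over partitions for an inequality on each single set, a form that
  passes directly to setwise limits.\<close>

lemma K_set_iff:
  assumes "\<alpha> \<in> pos_measures \<Omega>"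
  shows "\<mu> \<in> K_set \<Omega> \<alpha> \<longleftrightarrow> \<mu> \<in> vmeasures \<Omega> \<and> (\<forall>A\<in>borel_on \<Omega>. norm (\<mu> A) \<le> \<alpha> A)"
proof -
  have "norm (\<mu> A) \<le> \<alpha> A"
    if "A \<in> borel_on \<Omega>" "total_variation \<Omega> \<mu> A \<le> ennreal (\<alpha> A)" for A
    using order_trans[OF norm_le_total_variation[OF that(1,1) order_refl] that(2)]
    by (simp only: ennreal_le_iff[OF pos_measures_nonneg[OF assms]])
  moreover have "total_variation \<Omega> \<mu> B \<le> ennreal (\<alpha> B)"
    if "\<forall>A\<in>borel_on \<Omega>. norm (\<mu> A) \<le> \<alpha> A" for B
    using that by (intro total_variation_le[OF assms]) blast
  ultimately show ?thesis unfolding K_set_def by blast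
qed

text \<open>By finite additivity, the error after \<open>n\<close> terms of the series is the value
  of \<open>\<mu>\<close> on the remainder \<open>?V - ?U n\<close>. It is bounded by the mass that
  \<open>\<alpha>\<close> gives to this remainder, which vanishes because \<open>\<alpha>\<close> is
  countably additive. This is how a setwise limit is recognised as a measure.\<close>

lemma vmeasures_dominated:
  assumes \<alpha>: "\<alpha> \<in> pos_measures \<Omega>"
    and bound: "\<And>B. B \<in> borel_on \<Omega> \<Longrightarrow> norm (\<mu> B) \<le> \<alpha> B"
    and zero: "\<And>B. B \<notin> borel_on \<Omega> \<Longrightarrow> \<mu> B = 0"
    and add: "\<And>A B. A \<in> borel_on \<Omega> \<Longrightarrow> B \<in> borel_on \<Omega> \<Longrightarrow> A \<inter> B = {} \<Longrightarrow> \<mu> (A \<union> B) = \<mu> A + \<mu> B"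
  shows "\<mu> \<in> vmeasures \<Omega>"
proof (rule vmeasuresI[OF _ zero])
  fix A :: "nat \<Rightarrow> 'a set" assume A: "range A \<subseteq> borel_on \<Omega>" "disjoint_family A"
  note \<alpha>' = pos_measures_vmeasures[OF \<alpha>]
  let ?U = "\<lambda>n. \<Union>i<n. A i" and ?V = "\<Union>i. A i"
  have sets: "?U n \<in> borel_on \<Omega>" "?V \<in> borel_on \<Omega>" "A n \<in> borel_on \<Omega>" for n
    using A(1) by auto
  have disj: "?U n \<inter> A n = {}" for n
  proof -
    have "A i \<inter> A n = {}" if "i < n" for i
      using that by (intro disjoint_family_onD[OF A(2)]) auto
    then show ?thesis by blast
  qed
  have Suc: "?U (Suc n) = ?U n \<union> A n" for n by (auto simp: less_Suc_eq)
  have "\<mu> {} = 0" using add[of "{}" "{}"] by simp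
  then have \<mu>U: "\<mu> (?U n) = (\<Sum>i<n. \<mu> (A i))" for n
    by (induction n) (simp_all add: Suc add[OF sets(1,3) disj] del: UN_simps)
  have \<alpha>U: "\<alpha> (?U n) = (\<Sum>i<n. \<alpha> (A i))" for n
    by (induction n) (simp_all add: Suc vmeasures_Un[OF \<alpha>' sets(1,3) disj] vmeasures_empty[OF \<alpha>'] del: UN_simps)
  have "\<forall>\<^sub>F n in sequentially. norm ((\<Sum>i<n. \<mu> (A i)) - \<mu> ?V) \<le> \<alpha> ?V - (\<Sum>i<n. \<alpha> (A i))"
  proof (rule always_eventually, rule allI)
    fix n
    have sub: "?U n \<subseteq> ?V" by blast
    then have "?U n \<union> (?V - ?U n) = ?V" by blast
    with add[of "?U n" "?V - ?U n"] sets have "\<mu> ?V = \<mu> (?U n) + \<mu> (?V - ?U n)" by auto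
    then have "norm ((\<Sum>i<n. \<mu> (A i)) - \<mu> ?V) = norm (\<mu> (?V - ?U n))" by (simp add: \<mu>U)
    also have "\<dots> \<le> \<alpha> (?V - ?U n)" using sets by (intro bound) blast
    also have "\<dots> = \<alpha> ?V - (\<Sum>i<n. \<alpha> (A i))"
      using vmeasures_Diff[OF \<alpha>' sets(2) sets(1) sub] by (simp add: \<alpha>U)
    finally show "norm ((\<Sum>i<n. \<mu> (A i)) - \<mu> ?V) \<le> \<alpha> ?V - (\<Sum>i<n. \<alpha> (A i))" .
  qed
  moreover have "(\<lambda>n. \<alpha> ?V - (\<Sum>i<n. \<alpha> (A i))) \<longlonglongrightarrow> 0"
    using tendsto_diff[OF tendsto_const[of "\<alpha> ?V"] vmeasures_sums[OF \<alpha>' A, unfolded sums_def]]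
    by (simp only: diff_self)
  ultimately have "(\<lambda>n. (\<Sum>i<n. \<mu> (A i)) - \<mu> ?V) \<longlonglongrightarrow> 0"
    by (rule Lim_null_comparison)
  then show "(\<lambda>i. \<mu> (A i)) sums \<mu> ?V"
    unfolding sums_def by (rule Lim_null[THEN iffD2])
qed

section \<open>Approximation of Borel sets by finite unions from a countable base\<close>

lemma emeasure_pos_part_pos_measures:
  assumes "\<alpha> \<in> pos_measures \<Omega>" "B \<in> borel_on \<Omega>"
  shows "emeasure (pos_part \<Omega> \<alpha>) B = ennreal (\<alpha> B)"
proof -
  have "(SUP A \<in> {A \<in> borel_on \<Omega>. A \<subseteq> B}. ennreal (\<alpha> A)) = ennreal (\<alpha> B)"
    using assms by (intro antisym SUP_least SUP_upper ennreal_leI) (auto intro: pos_measures_mono)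
  then show ?thesis using assms by (simp add: emeasure_pos_part pos_measures_def)
qed

lemma sets_pos_part [simp, measurable_cong]: "sets (pos_part \<Omega> \<nu>) = borel_on \<Omega>"
  and space_pos_part [simp]: "space (pos_part \<Omega> \<nu>) = \<Omega>"
proof -
  have sp: "space (restrict_space borel \<Omega>) = \<Omega>" by (simp add: space_restrict_space)
  have "sigma_algebra \<Omega> (borel_on \<Omega>)"
    using sets.sigma_algebra_axioms[of "restrict_space borel \<Omega>"] by (simp only: sp)
  then show "sets (pos_part \<Omega> \<nu>) = borel_on \<Omega>" "space (pos_part \<Omega> \<nu>) = \<Omega>"
    unfolding pos_part_def
    by (simp_all add: sigma_algebra.sets_measure_of_eq space_measure_of_conv)
qed

text \<open>Outer regularity encloses the set in an open \<open>V\<close> of nearly the same mass.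
  As a countable union of base sets, \<open>V\<close> is exhausted from inside by finite
  unions.\<close>

lemma pos_measures_approx:
  fixes \<Omega> :: "'a::euclidean_space set" and U :: "nat \<Rightarrow> 'a set"
  assumes \<alpha>: "\<alpha> \<in> pos_measures \<Omega>" and B: "B \<in> borel_on \<Omega>" and e: "0 < e"
    and U: "\<And>n. open (U n)" "\<And>S. open S \<Longrightarrow> \<exists>k. S = \<Union>{U n |n. n \<in> k}"
  shows "\<exists>l. \<alpha> (B - (\<Union>i\<in>set l. U i) \<inter> \<Omega>) + \<alpha> ((\<Union>i\<in>set l. U i) \<inter> \<Omega> - B) < e"
proof -
  \<comment> \<open>Outer regularity is applied to a Borel measure on the whole space, so \<alpha>
    is extended by zero outside \<Omega> as a push-forward under the inclusion.\<close>
  define M where "M = distr (pos_part \<Omega> \<alpha>) borel (\<lambda>x. x)"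
  have [measurable]: "(\<lambda>x. x) \<in> measurable (pos_part \<Omega> \<alpha>) borel"
    by (intro measurable_cong_sets[THEN eqset_imp_iff, THEN iffD2, OF sets_pos_part refl])
      (auto intro: measurable_restrict_space1)
  have sets_M [simp]: "sets M = sets borel" by (simp add: M_def)
  have space_M [simp]: "space M = UNIV" by (simp add: M_def)
  have borel_on: "X \<inter> \<Omega> \<in> borel_on \<Omega>" if "X \<in> sets borel" for X
    using that by (auto simp: sets_restrict_space)
  have em: "emeasure M X = ennreal (\<alpha> (X \<inter> \<Omega>))" if "X \<in> sets borel" for X
    using that unfolding M_def
    by (simp add: emeasure_distr emeasure_pos_part_pos_measures[OF \<alpha>] borel_on)
  interpret M: finite_measure M by standard (simp add: em)
  have meas: "measure M X = \<alpha> (X \<inter> \<Omega>)" if "X \<in> sets borel" for X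
    using em[OF that] pos_measures_nonneg[OF \<alpha>] by (simp add: measure_def)
  obtain C where C: "C \<in> sets borel" "B = C \<inter> \<Omega>"
    using B by (auto simp: sets_restrict_space)
  \<comment> \<open>Finiteness of \<open>M\<close> makes the addition of \<open>e / 2\<close> a
    strict increase, so some open set containing \<open>C\<close> stays below this value.\<close>
  have "(INF V \<in> {V. C \<subseteq> V \<and> open V}. emeasure M V) < emeasure M C + ennreal (e / 2)"
    using e M.emeasure_finite[of C]
    by (subst outer_regular[symmetric]) (auto simp: C ennreal_add_left_cancel_less em
        simp flip: ennreal_plus intro!: ennreal_lessI pos_measures_nonneg[OF \<alpha>] add_nonneg_pos)
  then obtain V where V: "C \<subseteq> V" "open V" "emeasure M V < emeasure M C + ennreal (e / 2)"
    by (auto simp: INF_less_iff)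
  have "measure M V < measure M C + e / 2"
    using V e by (simp add: M.emeasure_eq_measure ennreal_less_iff flip: ennreal_plus)
  then have VC: "measure M (V - C) < e / 2"
    using V C by (subst M.finite_measure_Diff) auto
  obtain k where k: "V = \<Union>{U n |n. n \<in> k}" using U(2)[OF V(2)] by blast
  \<comment> \<open>The lists keep those indices of \<open>k\<close> that lie below
    \<open>n\<close>. Hence the unions \<open>W n\<close> increase to \<open>V\<close>, and
    continuity from below applies.\<close>
  define l where "l n = [i \<leftarrow> [0..<n]. i \<in> k]" for n
  define W where "W n = (\<Union>i\<in>set (l n). U i)" for n
  have openW: "open (W n)" for n using U(1) by (auto simp: W_def)
  then have borel: "V \<in> sets borel" "C \<in> sets borel" "W n \<in> sets borel" for n
    using V(2) C(1) by auto
  have "(\<lambda>n. measure M (W n)) \<longlonglongrightarrow> measure M (\<Union>n. W n)"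
    using openW by (intro M.finite_Lim_measure_incseq) (auto simp: incseq_def W_def l_def dest: less_le_trans)
  moreover have WV: "(\<Union>n. W n) = V" unfolding W_def l_def k by fastforce
  ultimately have "\<forall>\<^sub>F n in sequentially. measure M V - e / 2 < measure M (W n)"
    using e by (intro order_tendstoD(1)[where a = "measure M V - e / 2"]) auto
  then obtain n where n: "measure M V - e / 2 < measure M (W n)"
    by (auto simp: eventually_sequentially)
  have WnV: "W n \<subseteq> V" using WV by blast
  \<comment> \<open>Both \<open>C\<close> and \<open>W n\<close> lie in \<open>V\<close>. One half
    of the symmetric difference is therefore contained in \<open>V - W n\<close>, the other in
    \<open>V - C\<close>, and each costs at most \<open>e / 2\<close>.\<close>
  have "measure M (V - W n) < e / 2"
    using n V(2) openW WnV by (subst M.finite_measure_Diff) auto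
  moreover have "\<alpha> (B - W n \<inter> \<Omega>) \<le> measure M (V - W n)"
  proof -
    have "(C - W n) \<inter> \<Omega> \<in> borel_on \<Omega>" "(V - W n) \<inter> \<Omega> \<in> borel_on \<Omega>"
      using borel by (auto intro!: borel_on)
    moreover have "B - W n \<inter> \<Omega> = (C - W n) \<inter> \<Omega>" using C by blast
    ultimately show ?thesis
      using V openW by (subst meas) (auto simp: borel intro!: pos_measures_mono[OF \<alpha>])
  qed
  moreover have "\<alpha> (W n \<inter> \<Omega> - B) \<le> measure M (V - C)"
  proof -
    have "(W n - C) \<inter> \<Omega> \<in> borel_on \<Omega>" "(V - C) \<inter> \<Omega> \<in> borel_on \<Omega>"
      using borel by (auto intro!: borel_on)
    moreover have "W n \<inter> \<Omega> - B = (W n - C) \<inter> \<Omega>" using C by blast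
    ultimately show ?thesis
      using V C WnV by (subst meas) (auto simp: borel intro!: pos_measures_mono[OF \<alpha>])
  qed
  ultimately show ?thesis using VC unfolding W_def by (intro exI[of _ "l n"]) simp
qed

section \<open>Extraction of a setwise convergent subsequence\<close>

lemma setwise_subsequence:
  fixes \<Omega> :: "'a::euclidean_space set" and \<mu> :: "nat \<Rightarrow> 'a set \<Rightarrow> 'b::euclidean_space"
  assumes \<beta>: "\<And>k. \<beta> k \<in> pos_measures \<Omega>" and \<alpha>: "\<alpha> \<in> pos_measures \<Omega>"
    and lim: "\<And>B. B \<in> borel_on \<Omega> \<Longrightarrow> (\<lambda>k. \<beta> k B) \<longlonglongrightarrow> \<alpha> B"
    and \<mu>: "\<And>k. \<mu> k \<in> K_set \<Omega> (\<beta> k)"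
  shows "\<exists>r \<nu>. strict_mono r \<and> \<nu> \<in> K_set \<Omega> \<alpha> \<and> (\<forall>B. (\<lambda>k. \<mu> (r k) B) \<longlonglongrightarrow> \<nu> B)"
proof -
  have \<mu>v: "\<mu> k \<in> vmeasures \<Omega>" and dom: "B \<in> borel_on \<Omega> \<Longrightarrow> norm (\<mu> k B) \<le> \<beta> k B" for k B
    using \<mu>[of k] unfolding K_set_iff[OF \<beta>] by simp_all
  obtain U :: "nat \<Rightarrow> 'a set" where "inj U"
    and U: "\<And>n. open (U n)" "\<And>S. open S \<Longrightarrow> \<exists>k. S = \<Union>{U n |n. n \<in> k}"
    by (rule univ_second_countable_sequence) (rule that)
  \<comment> \<open>Finite unions are indexed by \<open>nat list\<close> because this type is
    countable: the functions on it form a first countable space, where compactness gives sequential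
    compactness.\<close>
  define W where "W l = (\<Union>i\<in>set l. U i) \<inter> \<Omega>" for l :: "nat list"
  have "open (\<Union>i\<in>set l. U i)" for l using U(1) by auto
  then have W: "W l \<in> borel_on \<Omega>" for l
    by (auto simp: W_def sets_restrict_space)
  obtain c where c: "\<And>k. norm (\<beta> k \<Omega>) \<le> c"
    using convergent_imp_Bseq[OF convergentI[OF lim[OF Omega_in_borel_on]]] by (auto simp: Bseq_def)
  have bound: "norm (\<mu> k (W l)) \<le> c" for k l
  proof -
    have "W l \<subseteq> \<Omega>" by (auto simp: W_def)
    then have "\<beta> k (W l) \<le> \<beta> k \<Omega>" by (intro pos_measures_mono[OF \<beta>] W Omega_in_borel_on)
    then show ?thesis using dom[OF W, of k l] c[of k] by simp
  qed
  \<comment> \<open>The diagonal argument takes the form of Tychonoff's theorem: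
    \<open>\<mu> k\<close> is viewed as the point \<open>\<lambda>l. \<mu> k (W l)\<close> of a
    product of closed balls of radius \<open>c\<close>.\<close>
  have "compact (PiE UNIV (\<lambda>_::nat list. cball (0::'b) c))"
    using compactin_PiE[of "\<lambda>_. euclidean" UNIV "\<lambda>_::nat list. cball (0::'b) c"]
    by (simp add: euclidean_product_topology)
  then have "seq_compact (PiE UNIV (\<lambda>_::nat list. cball (0::'b) c))"
    by (rule compact_imp_seq_compact)
  moreover have "\<forall>k. (\<lambda>l. \<mu> k (W l)) \<in> PiE UNIV (\<lambda>_. cball 0 c)"
    using bound by auto
  ultimately obtain L r where r: "strict_mono r" and L: "((\<lambda>k l. \<mu> k (W l)) \<circ> r) \<longlonglongrightarrow> L"
    by (rule seq_compactE)
  \<comment> \<open>Continuity of the coordinate projections turns convergence in the product into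
    convergence on each \<open>W l\<close>.\<close>
  have "isCont (\<lambda>x. x l) L" for l
    by (rule continuous_on_interior[OF continuous_on_product_coordinates]) simp
  from isCont_tendsto_compose[OF this L] have "(\<lambda>k. \<mu> (r k) (W l)) \<longlonglongrightarrow> L l" for l
    by (simp add: o_def)
  then have conv_W: "Cauchy (\<lambda>k. \<mu> (r k) (W l))" for l
    by (rule LIMSEQ_imp_Cauchy)
  have "convergent (\<lambda>k. \<mu> (r k) B)" if B: "B \<in> borel_on \<Omega>" for B
  proof (rule Cauchy_convergent, rule metric_CauchyI)
    fix e :: real assume e: "0 < e"
    then obtain l where l: "\<alpha> (B - W l) + \<alpha> (W l - B) < e / 3"
      using pos_measures_approx[OF \<alpha> B _ U, of "e / 3"] unfolding W_def by auto
    have sets: "B - W l \<in> borel_on \<Omega>" "W l - B \<in> borel_on \<Omega>" "B \<inter> W l \<in> borel_on \<Omega>"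
      using B W by blast+
    have near: "norm (\<mu> k B - \<mu> k (W l)) \<le> \<beta> k (B - W l) + \<beta> k (W l - B)" for k
    proof -
      \<comment> \<open>Removing the common part \<open>B \<inter> W l\<close> from both sets leaves
        only the two halves of the symmetric difference.\<close>
      have "\<mu> k (B - W l) = \<mu> k (B - B \<inter> W l)" "\<mu> k (W l - B) = \<mu> k (W l - B \<inter> W l)"
        by (simp_all add: Diff_Int)
      then have "\<mu> k B - \<mu> k (W l) = \<mu> k (B - W l) - \<mu> k (W l - B)"
        using vmeasures_Diff[OF \<mu>v[of k] B sets(3)] vmeasures_Diff[OF \<mu>v[of k] W sets(3)] by simp
      then have "norm (\<mu> k B - \<mu> k (W l)) \<le> norm (\<mu> k (B - W l)) + norm (\<mu> k (W l - B))"
        by (simp add: norm_triangle_ineq4)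
      also have "\<dots> \<le> \<beta> k (B - W l) + \<beta> k (W l - B)"
        using sets by (intro add_mono dom)
      finally show ?thesis .
    qed
    \<comment> \<open>The list \<open>l\<close> was chosen for \<alpha> alone. Since the inequality
      is strict and these two sets are fixed, it transfers to \<open>\<beta> (r k)\<close> for all
      large \<open>k\<close>.\<close>
    have "(\<lambda>k. \<beta> (r k) (B - W l) + \<beta> (r k) (W l - B)) \<longlonglongrightarrow> \<alpha> (B - W l) + \<alpha> (W l - B)"
      using LIMSEQ_subseq_LIMSEQ[OF tendsto_add[OF lim[OF sets(1)] lim[OF sets(2)]] r]
      by (simp add: o_def)
    from order_tendstoD(2)[OF this l] obtain N1
      where N1: "\<And>k. N1 \<le> k \<Longrightarrow> \<beta> (r k) (B - W l) + \<beta> (r k) (W l - B) < e / 3"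
      by (auto simp: eventually_sequentially)
    obtain N2 where N2: "\<And>m n. N2 \<le> m \<Longrightarrow> N2 \<le> n \<Longrightarrow> dist (\<mu> (r m) (W l)) (\<mu> (r n) (W l)) < e / 3"
      using metric_CauchyD[OF conv_W[of l], of "e / 3"] e by auto
    show "\<exists>M. \<forall>m\<ge>M. \<forall>n\<ge>M. dist (\<mu> (r m) B) (\<mu> (r n) B) < e"
    proof (intro exI allI impI)
      fix m n assume mn: "max N1 N2 \<le> m" "max N1 N2 \<le> n"
      have "dist (\<mu> (r m) B) (\<mu> (r m) (W l)) < e / 3" "dist (\<mu> (r n) B) (\<mu> (r n) (W l)) < e / 3"
        using near[of "r m"] near[of "r n"] N1[of m] N1[of n] mn by (simp_all add: dist_norm)
      moreover have "dist (\<mu> (r m) (W l)) (\<mu> (r n) (W l)) < e / 3"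
        using N2 mn by simp
      ultimately show "dist (\<mu> (r m) B) (\<mu> (r n) B) < e"
        by metric
    qed
  qed
  \<comment> \<open>The default value 0 off the Borel sets gives convergence at every argument, so
    the limit can be chosen as a total function.\<close>
  moreover have "convergent (\<lambda>k. \<mu> (r k) B)" if "B \<notin> borel_on \<Omega>" for B
    using vmeasures_outside[OF \<mu>v that] by (simp add: convergent_const)
  ultimately have "\<exists>x. (\<lambda>k. \<mu> (r k) B) \<longlonglongrightarrow> x" for B
    unfolding convergent_def by blast
  then obtain \<nu> where \<nu>: "\<And>B. (\<lambda>k. \<mu> (r k) B) \<longlonglongrightarrow> \<nu> B" by metis
  have \<nu>_le: "norm (\<nu> B) \<le> \<alpha> B" if "B \<in> borel_on \<Omega>" for B
  proof (rule LIMSEQ_le[OF tendsto_norm[OF \<nu>]])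
    show "(\<lambda>k. \<beta> (r k) B) \<longlonglongrightarrow> \<alpha> B"
      using LIMSEQ_subseq_LIMSEQ[OF lim[OF that] r] by (simp add: o_def)
  qed (use dom[OF that] in blast)
  have "\<nu> \<in> vmeasures \<Omega>"
  proof (rule vmeasures_dominated[OF \<alpha> \<nu>_le])
    fix B assume "B \<notin> borel_on \<Omega>"
    then show "\<nu> B = 0"
      using \<nu>[of B] vmeasures_outside[OF \<mu>v] by (simp add: LIMSEQ_const_iff)
  next
    fix A B assume AB: "A \<in> borel_on \<Omega>" "B \<in> borel_on \<Omega>" "A \<inter> B = {}"
    show "\<nu> (A \<union> B) = \<nu> A + \<nu> B"
      using \<nu>[of "A \<union> B"] tendsto_add[OF \<nu>[of A] \<nu>[of B]]
      by (auto simp: vmeasures_Un[OF \<mu>v AB] intro: LIMSEQ_unique)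
  qed
  with \<nu>_le have "\<nu> \<in> K_set \<Omega> \<alpha>" by (simp add: K_set_iff[OF \<alpha>])
  with r \<nu> show ?thesis by blast
qed

section \<open>Jordan decomposition and integrals under setwise convergence\<close>

lemma vmeasures_uminus: "\<nu> \<in> vmeasures \<Omega> \<Longrightarrow> (\<lambda>B. - \<nu> B) \<in> vmeasures \<Omega>"
  by (rule vmeasuresI) (simp_all add: sums_minus vmeasures_sums vmeasures_outside)

lemma vmeasures_vec_nth: "\<mu> \<in> vmeasures \<Omega> \<Longrightarrow> (\<lambda>B. \<mu> B $ i) \<in> vmeasures \<Omega>"
  by (rule vmeasuresI)
    (simp_all add: bounded_linear.sums[OF bounded_linear_vec_nth] vmeasures_sums vmeasures_outside)

context
  fixes \<Omega> :: "'a::topological_space set" and \<nu> :: "'a set \<Rightarrow> real" and c :: real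
  assumes \<nu>: "\<nu> \<in> vmeasures \<Omega>" and bound: "\<forall>A\<in>borel_on \<Omega>. \<bar>\<nu> A\<bar> \<le> c"
begin

lemma emeasure_pos_part_le:
  assumes B: "B \<in> borel_on \<Omega>" and le: "\<And>A. A \<in> borel_on \<Omega> \<Longrightarrow> A \<subseteq> B \<Longrightarrow> \<nu> A \<le> d"
  shows "emeasure (pos_part \<Omega> \<nu>) B \<le> ennreal d"
  unfolding emeasure_pos_part[OF \<nu> B] by (rule SUP_least) (simp add: ennreal_leI le)

lemma finite_measure_pos_part: "finite_measure (pos_part \<Omega> \<nu>)"
proof
  have "emeasure (pos_part \<Omega> \<nu>) \<Omega> \<le> ennreal c"
    using bound by (intro emeasure_pos_part_le) (auto simp: abs_le_iff)
  also have "\<dots> < \<infinity>" by simp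
  finally show "emeasure (pos_part \<Omega> \<nu>) (space (pos_part \<Omega> \<nu>)) \<noteq> \<infinity>" by simp
qed

lemma measure_pos_part_le:
  assumes "B \<in> borel_on \<Omega>" and "\<And>A. A \<in> borel_on \<Omega> \<Longrightarrow> A \<subseteq> B \<Longrightarrow> \<nu> A \<le> d"
  shows "measure (pos_part \<Omega> \<nu>) B \<le> d"
proof -
  interpret finite_measure "pos_part \<Omega> \<nu>" by (rule finite_measure_pos_part)
  \<comment> \<open>Taking the empty set for \<open>A\<close> forces \<open>d\<close> to be
    nonnegative, which rules out truncation by \<open>ennreal\<close>.\<close>
  have "0 \<le> d" using assms(2)[of "{}"] vmeasures_empty[OF \<nu>] by simp
  then show ?thesis
    using emeasure_pos_part_le[OF assms] by (simp add: emeasure_eq_measure)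
qed

lemma measure_pos_part_ge:
  assumes "B \<in> borel_on \<Omega>" "A \<in> borel_on \<Omega>" "A \<subseteq> B"
  shows "\<nu> A \<le> measure (pos_part \<Omega> \<nu>) B"
proof -
  interpret finite_measure "pos_part \<Omega> \<nu>" by (rule finite_measure_pos_part)
  have "ennreal (\<nu> A) \<le> emeasure (pos_part \<Omega> \<nu>) B"
    unfolding emeasure_pos_part[OF \<nu> assms(1)] using assms by (intro SUP_upper) auto
  then show ?thesis by (cases "0 \<le> \<nu> A") (auto simp: emeasure_eq_measure intro: order_trans[of _ 0])
qed

end

text \<open>For \<open>A \<subseteq> B\<close>, the value \<open>\<nu> A\<close> equals
  \<open>\<nu> B\<close> plus the value of the negated measure on \<open>B - A\<close>, hence is at
  most \<open>\<nu> B\<close> plus the negative part of \<open>B\<close>. The supremum over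
  \<open>A\<close> gives one inequality; exchanging \<open>\<nu>\<close> and its negative gives the
  other.\<close>

lemma Jordan_decomposition:
  fixes \<nu> :: "'a::topological_space set \<Rightarrow> real"
  assumes \<nu>: "\<nu> \<in> vmeasures \<Omega>" and bound: "\<forall>A\<in>borel_on \<Omega>. \<bar>\<nu> A\<bar> \<le> c"
    and B: "B \<in> borel_on \<Omega>"
  shows "measure (pos_part \<Omega> \<nu>) B - measure (pos_part \<Omega> (\<lambda>B. - \<nu> B)) B = \<nu> B"
proof -
  have minus: "\<forall>A\<in>borel_on \<Omega>. \<bar>- \<nu> A\<bar> \<le> c" using bound by simp
  note \<nu>' = vmeasures_uminus[OF \<nu>]
  have "measure (pos_part \<Omega> \<nu>) B \<le> \<nu> B + measure (pos_part \<Omega> (\<lambda>B. - \<nu> B)) B"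
  proof (rule measure_pos_part_le[OF \<nu> bound B])
    fix A assume A: "A \<in> borel_on \<Omega>" "A \<subseteq> B"
    then show "\<nu> A \<le> \<nu> B + measure (pos_part \<Omega> (\<lambda>B. - \<nu> B)) B"
      using measure_pos_part_ge[OF \<nu>' minus B sets.Diff[OF B A(1)]] vmeasures_Diff[OF \<nu> B A] by auto
  qed
  moreover have "measure (pos_part \<Omega> (\<lambda>B. - \<nu> B)) B \<le> measure (pos_part \<Omega> \<nu>) B - \<nu> B"
  proof (rule measure_pos_part_le[OF \<nu>' minus B])
    fix A assume A: "A \<in> borel_on \<Omega>" "A \<subseteq> B"
    then show "- \<nu> A \<le> measure (pos_part \<Omega> \<nu>) B - \<nu> B"
      using measure_pos_part_ge[OF \<nu> bound B sets.Diff[OF B A(1)]] vmeasures_Diff[OF \<nu> B A] by auto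
  qed
  ultimately show ?thesis by simp
qed

text \<open>Linearity and the Jordan decomposition express the integral of a step function through
  finitely many values of \<open>\<nu>\<close>, the quantities that setwise convergence
  controls.\<close>

lemma signed_integral_sum_indicator:
  fixes \<nu> :: "'a::topological_space set \<Rightarrow> real"
  assumes \<nu>: "\<nu> \<in> vmeasures \<Omega>" and bound: "\<forall>A\<in>borel_on \<Omega>. \<bar>\<nu> A\<bar> \<le> c"
    and A: "\<And>j. j \<in> J \<Longrightarrow> A j \<in> borel_on \<Omega>"
  shows "signed_integral \<Omega> \<nu> (\<lambda>x. \<Sum>j\<in>J. a j * indicator (A j) x) = (\<Sum>j\<in>J. a j * \<nu> (A j))"
proof -
  have minus: "\<forall>A\<in>borel_on \<Omega>. \<bar>- \<nu> A\<bar> \<le> c" using bound by simp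
  have *: "(LINT x|pos_part \<Omega> \<sigma>. (\<Sum>j\<in>J. a j * indicator (A j) x))
      = (\<Sum>j\<in>J. a j * measure (pos_part \<Omega> \<sigma>) (A j))"
    if \<sigma>: "\<sigma> \<in> vmeasures \<Omega>" "\<forall>A\<in>borel_on \<Omega>. \<bar>\<sigma> A\<bar> \<le> c" for \<sigma> :: "'a set \<Rightarrow> real"
  proof -
    interpret finite_measure "pos_part \<Omega> \<sigma>" by (rule finite_measure_pos_part[OF \<sigma>])
    \<comment> \<open>The integral of an indicator is the measure of its set intersected with the
      space.\<close>
    have sub: "A j \<inter> \<Omega> = A j" if "j \<in> J" for j
      using sets.sets_into_space[of "A j" "pos_part \<Omega> \<sigma>"] A[OF that] by auto
    show ?thesis
      using A sub by (subst Bochner_Integration.integral_sum)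
        (auto intro!: integrable_mult_right integrable_real_indicator sum.cong simp: emeasure_eq_measure)
  qed
  show ?thesis
    unfolding signed_integral_def *[OF \<nu> bound] *[OF vmeasures_uminus[OF \<nu>] minus]
    by (simp add: Jordan_decomposition[OF \<nu> bound A] cong: sum.cong
        flip: sum_subtractf right_diff_distrib)
qed

text \<open>The positive and negative parts each have mass at most \<open>c\<close>, so each
  contributes at most \<open>e * c\<close>; hence the factor 2.\<close>

lemma signed_integral_diff_le:
  fixes \<nu> :: "'a::topological_space set \<Rightarrow> real"
  assumes \<nu>: "\<nu> \<in> vmeasures \<Omega>" and bound: "\<forall>A\<in>borel_on \<Omega>. \<bar>\<nu> A\<bar> \<le> c"
    and f: "f \<in> borel_measurable (restrict_space borel \<Omega>)" "\<And>x. x \<in> \<Omega> \<Longrightarrow> \<bar>f x\<bar> \<le> m"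
    and g: "g \<in> borel_measurable (restrict_space borel \<Omega>)"
    and e: "\<And>x. x \<in> \<Omega> \<Longrightarrow> \<bar>f x - g x\<bar> \<le> e" "0 \<le> e"
  shows "\<bar>signed_integral \<Omega> \<nu> f - signed_integral \<Omega> \<nu> g\<bar> \<le> 2 * (e * c)"
proof -
  have minus: "\<forall>A\<in>borel_on \<Omega>. \<bar>- \<nu> A\<bar> \<le> c" using bound by simp
  have *: "\<bar>(LINT x|pos_part \<Omega> \<sigma>. f x) - (LINT x|pos_part \<Omega> \<sigma>. g x)\<bar> \<le> e * c"
    if \<sigma>: "\<sigma> \<in> vmeasures \<Omega>" "\<forall>A\<in>borel_on \<Omega>. \<bar>\<sigma> A\<bar> \<le> c" for \<sigma> :: "'a set \<Rightarrow> real"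
  proof -
    interpret finite_measure "pos_part \<Omega> \<sigma>" by (rule finite_measure_pos_part[OF \<sigma>])
    have meas: "f \<in> borel_measurable (pos_part \<Omega> \<sigma>)" "g \<in> borel_measurable (pos_part \<Omega> \<sigma>)"
      using f(1) g by (simp_all cong: measurable_cong_sets)
    have intf: "integrable (pos_part \<Omega> \<sigma>) f"
      using meas f(2) by (intro integrable_const_bound[of _ m]) auto
    have "\<bar>g x\<bar> \<le> m + e" if "x \<in> \<Omega>" for x
      using f(2)[OF that] e(1)[OF that] by linarith
    then have intg: "integrable (pos_part \<Omega> \<sigma>) g"
      using meas by (intro integrable_const_bound[of _ "m + e"]) auto
    have "\<bar>(LINT x|pos_part \<Omega> \<sigma>. f x) - (LINT x|pos_part \<Omega> \<sigma>. g x)\<bar>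
        = norm (LINT x|pos_part \<Omega> \<sigma>. f x - g x)"
      using intf intg by simp
    also have "\<dots> \<le> (LINT x|pos_part \<Omega> \<sigma>. norm (f x - g x))"
      by (rule integral_norm_bound)
    also have "\<dots> \<le> (LINT x|pos_part \<Omega> \<sigma>. e)"
      using intf intg e(1) by (intro integral_mono) auto
    also have "\<dots> = e * measure (pos_part \<Omega> \<sigma>) \<Omega>" by simp
    also have "\<dots> \<le> e * c"
      using \<sigma>(2) by (intro mult_left_mono measure_pos_part_le[OF \<sigma>] e(2)) (auto simp: abs_le_iff)
    finally show ?thesis .
  qed
  show ?thesis
    using *[OF \<nu> bound] *[OF vmeasures_uminus[OF \<nu>] minus]
    unfolding signed_integral_def by linarith
qed

text \<open>The values of \<open>f\<close> are rounded down to integer multiples of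
  \<open>e\<close>. The bound \<open>m\<close> leaves finitely many multiples, and the level sets of
  the rounded function are Borel.\<close>

lemma bounded_borel_step_approx:
  fixes f :: "'a::topological_space \<Rightarrow> real"
  assumes f: "f \<in> borel_measurable (restrict_space borel \<Omega>)" "\<forall>x\<in>\<Omega>. \<bar>f x\<bar> \<le> m" and e: "0 < e"
  obtains J :: "int set" and a A where "finite J" "\<And>j. j \<in> J \<Longrightarrow> A j \<in> borel_on \<Omega>"
    "\<forall>x\<in>\<Omega>. \<bar>f x - (\<Sum>j\<in>J. a j * indicator (A j) x)\<bar> \<le> e"
proof
  let ?J = "{\<lfloor>- m / e\<rfloor>..\<lfloor>m / e\<rfloor>}" and ?A = "\<lambda>j. {x \<in> \<Omega>. \<lfloor>f x / e\<rfloor> = j}"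
  show "finite ?J" by simp
  have "{x \<in> space (restrict_space borel \<Omega>). \<lfloor>f x / e\<rfloor> = j} \<in> borel_on \<Omega>" for j
    using f(1) by measurable
  then show "?A j \<in> borel_on \<Omega>" for j by (simp add: space_restrict_space)
  show "\<forall>x\<in>\<Omega>. \<bar>f x - (\<Sum>j\<in>?J. e * real_of_int j * indicator (?A j) x)\<bar> \<le> e"
  proof
    fix x assume x: "x \<in> \<Omega>"
    have "- m \<le> f x" "f x \<le> m" using bspec[OF f(2) x] by linarith+
    then have "- m / e \<le> f x / e" "f x / e \<le> m / e" using e by (simp_all only: divide_right_mono less_imp_le)
    then have J: "\<lfloor>f x / e\<rfloor> \<in> ?J" by (simp only: floor_mono atLeastAtMost_iff simp_thms)
    \<comment> \<open>Only the level set with index \<open>\<lfloor>f x / e\<rfloor>\<close>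
      contains \<open>x\<close>, so a single summand survives.\<close>
    have "(\<Sum>j\<in>?J. e * real_of_int j * indicator (?A j) x)
        = (\<Sum>j\<in>?J. if \<lfloor>f x / e\<rfloor> = j then e * real_of_int j else 0)"
      using x by (intro sum.cong) (auto simp: indicator_def)
    also have "\<dots> = e * \<lfloor>f x / e\<rfloor>" using J by simp
    finally have "f x - (\<Sum>j\<in>?J. e * real_of_int j * indicator (?A j) x) = e * (f x / e - \<lfloor>f x / e\<rfloor>)"
      using e by (simp add: right_diff_distrib)
    moreover have "0 \<le> f x / e - \<lfloor>f x / e\<rfloor>" "f x / e - \<lfloor>f x / e\<rfloor> \<le> 1" by linarith+
    ultimately show "\<bar>f x - (\<Sum>j\<in>?J. e * real_of_int j * indicator (?A j) x)\<bar> \<le> e"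
      using e by (simp add: abs_mult mult_left_le)
  qed
qed

text \<open>One step function approximates \<open>f\<close> uniformly, and the common bound
  \<open>c\<close> makes the resulting error in the integrals uniform in \<open>k\<close>. On the
  step function itself convergence is setwise convergence.\<close>

lemma setwise_imp_signed_integral:
  fixes \<nu> :: "'a::topological_space set \<Rightarrow> real"
  assumes \<sigma>: "\<And>k. \<sigma> k \<in> vmeasures \<Omega>" "\<And>k. \<forall>A\<in>borel_on \<Omega>. \<bar>\<sigma> k A\<bar> \<le> c"
    and \<nu>: "\<nu> \<in> vmeasures \<Omega>"
    and lim: "\<And>A. A \<in> borel_on \<Omega> \<Longrightarrow> (\<lambda>k. \<sigma> k A) \<longlonglongrightarrow> \<nu> A"
    and f: "f \<in> borel_measurable (restrict_space borel \<Omega>)" "\<And>x. x \<in> \<Omega> \<Longrightarrow> \<bar>f x\<bar> \<le> m"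
  shows "(\<lambda>k. signed_integral \<Omega> (\<sigma> k) f) \<longlonglongrightarrow> signed_integral \<Omega> \<nu> f"
proof (rule LIMSEQ_I)
  fix e :: real assume e: "0 < e"
  have \<nu>c: "\<forall>A\<in>borel_on \<Omega>. \<bar>\<nu> A\<bar> \<le> c"
    using \<sigma>(2) by (intro ballI LIMSEQ_le_const2[OF tendsto_rabs[OF lim]]) auto
  have c: "0 \<le> c" using bspec[OF \<nu>c Omega_in_borel_on] by linarith
  \<comment> \<open>Chosen so that the error \<open>2 * (d * c)\<close> is at most
    \<open>e / 3\<close>; \<open>c + 1\<close> keeps the denominator positive when \<open>c\<close>
    is zero.\<close>
  define d where "d = e / (6 * (c + 1))"
  have d: "0 < d" using c e by (simp add: d_def)
  have "d * c \<le> d * (c + 1)" using d by simp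
  also have "\<dots> = e / 6" using c by (simp add: d_def divide_simps)
  finally have dc: "2 * (d * c) \<le> e / 3" by simp
  obtain J :: "int set" and a A where J: "finite J" "\<And>j. j \<in> J \<Longrightarrow> A j \<in> borel_on \<Omega>"
    "\<forall>x\<in>\<Omega>. \<bar>f x - (\<Sum>j\<in>J. a j * indicator (A j) x)\<bar> \<le> d"
    by (rule bounded_borel_step_approx[OF f(1) _ d]) (use f(2) in blast, rule that)
  define g where "g = (\<lambda>x. \<Sum>j\<in>J. a j * indicator (A j) x)"
  have g: "g \<in> borel_measurable (restrict_space borel \<Omega>)"
    unfolding g_def using J(2)
    by (intro borel_measurable_sum borel_measurable_times borel_measurable_const borel_measurable_indicator)
  have fg: "\<bar>f x - g x\<bar> \<le> d" if "x \<in> \<Omega>" for x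
    unfolding g_def using J(3) that by blast
  have near_\<sigma>: "\<bar>signed_integral \<Omega> (\<sigma> k) f - signed_integral \<Omega> (\<sigma> k) g\<bar> \<le> e / 3" for k
    using signed_integral_diff_le[OF \<sigma> f g fg less_imp_le[OF d]] dc by (rule order_trans)
  have near_\<nu>: "\<bar>signed_integral \<Omega> \<nu> f - signed_integral \<Omega> \<nu> g\<bar> \<le> e / 3"
    using signed_integral_diff_le[OF \<nu> \<nu>c f g fg less_imp_le[OF d]] dc by (rule order_trans)
  have step: "signed_integral \<Omega> \<tau> g = (\<Sum>j\<in>J. a j * \<tau> (A j))"
    if "\<tau> \<in> vmeasures \<Omega>" "\<forall>A\<in>borel_on \<Omega>. \<bar>\<tau> A\<bar> \<le> c" for \<tau> :: "'a set \<Rightarrow> real"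
    unfolding g_def by (rule signed_integral_sum_indicator[OF that]) (rule J(2))
  have "(\<lambda>k. signed_integral \<Omega> (\<sigma> k) g) \<longlonglongrightarrow> signed_integral \<Omega> \<nu> g"
    unfolding step[OF \<sigma>] step[OF \<nu> \<nu>c] by (intro tendsto_intros lim J(2))
  from LIMSEQ_D[OF this, of "e / 3"] e obtain N
    where N: "\<And>k. N \<le> k \<Longrightarrow> \<bar>signed_integral \<Omega> (\<sigma> k) g - signed_integral \<Omega> \<nu> g\<bar> < e / 3"
    by auto
  have "norm (signed_integral \<Omega> (\<sigma> k) f - signed_integral \<Omega> \<nu> f) < e" if "N \<le> k" for k
    using near_\<sigma>[of k] near_\<nu> N[OF that] unfolding real_norm_def by linarith
  then show "\<exists>N. \<forall>k\<ge>N. norm (signed_integral \<Omega> (\<sigma> k) f - signed_integral \<Omega> \<nu> f) < e"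
    by blast
qed

text \<open>The functionals split into components, and each component of a test function is bounded
  and Borel on \<Omega>.\<close>

lemma setwise_imp_narrow:
  fixes \<mu> :: "nat \<Rightarrow> 'a::topological_space set \<Rightarrow> real ^ 'n"
  assumes \<mu>: "\<And>k. \<mu> k \<in> vmeasures \<Omega>" "\<And>k A. A \<in> borel_on \<Omega> \<Longrightarrow> norm (\<mu> k A) \<le> c"
    and \<nu>: "\<nu> \<in> vmeasures \<Omega>"
    and lim: "\<And>A. A \<in> borel_on \<Omega> \<Longrightarrow> (\<lambda>k. \<mu> k A) \<longlonglongrightarrow> \<nu> A"
  shows "limitin (narrow_topology \<Omega>) \<mu> \<nu> sequentially"
  unfolding limitin_narrow_topology[OF \<mu>(1) \<nu>] vec_integral_def
proof (intro ballI tendsto_sum)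
  fix \<phi> :: "'a \<Rightarrow> real ^ 'n" and i :: 'n
  assume "\<phi> \<in> bounded_continuous_on \<Omega>"
  then have cont: "continuous_on \<Omega> \<phi>" and "bounded (\<phi> ` \<Omega>)"
    by (auto simp: bounded_continuous_on_def)
  then obtain m where m: "\<And>x. x \<in> \<Omega> \<Longrightarrow> norm (\<phi> x) \<le> m"
    by (auto simp: bounded_iff)
  show "(\<lambda>k. signed_integral \<Omega> (\<lambda>B. \<mu> k B $ i) (\<lambda>x. \<phi> x $ i))
      \<longlonglongrightarrow> signed_integral \<Omega> (\<lambda>B. \<nu> B $ i) (\<lambda>x. \<phi> x $ i)"
  proof (rule setwise_imp_signed_integral)
    show "(\<lambda>x. \<phi> x $ i) \<in> borel_measurable (restrict_space borel \<Omega>)"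
      using cont by (intro borel_measurable_continuous_on_restrict continuous_intros)
    show "\<forall>A\<in>borel_on \<Omega>. \<bar>\<mu> k A $ i\<bar> \<le> c" for k
      using order_trans[OF component_le_norm_cart \<mu>(2)] by blast
    show "\<bar>\<phi> x $ i\<bar> \<le> m" if "x \<in> \<Omega>" for x
      using component_le_norm_cart m[OF that] by (rule order_trans)
  qed (simp_all add: vmeasures_vec_nth \<mu>(1) \<nu> tendsto_vec_nth lim)
qed

text \<open>Stated for varying bounds \<open>\<beta> k\<close> with a setwise limit, so that one
  lemma serves both a constant sequence of bounds and the strongly convergent one.\<close>

lemma K_set_narrow_subsequence:
  fixes \<Omega> :: "'a::euclidean_space set" and \<mu> :: "nat \<Rightarrow> 'a set \<Rightarrow> real ^ 'n"
  assumes \<beta>: "\<And>k. \<beta> k \<in> pos_measures \<Omega>" and \<alpha>: "\<alpha> \<in> pos_measures \<Omega>"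
    and lim: "\<And>B. B \<in> borel_on \<Omega> \<Longrightarrow> (\<lambda>k. \<beta> k B) \<longlonglongrightarrow> \<alpha> B"
    and \<mu>: "\<And>k. \<mu> k \<in> K_set \<Omega> (\<beta> k)"
  shows "\<exists>r \<nu>. strict_mono r \<and> \<nu> \<in> K_set \<Omega> \<alpha> \<and>
    limitin (narrow_topology \<Omega>) (\<mu> \<circ> r) \<nu> sequentially"
proof -
  obtain r \<nu> where r: "strict_mono r" and \<nu>: "\<nu> \<in> K_set \<Omega> \<alpha>" and conv: "\<And>B. (\<lambda>k. \<mu> (r k) B) \<longlonglongrightarrow> \<nu> B"
    using setwise_subsequence[OF assms] by blast
  have \<mu>v: "\<mu> k \<in> vmeasures \<Omega>" and dom: "B \<in> borel_on \<Omega> \<Longrightarrow> norm (\<mu> k B) \<le> \<beta> k B" for k B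
    using \<mu>[of k] unfolding K_set_iff[OF \<beta>] by simp_all
  obtain c where c: "\<And>k. norm (\<beta> k \<Omega>) \<le> c"
    using convergent_imp_Bseq[OF convergentI[OF lim[OF Omega_in_borel_on]]] by (auto simp: Bseq_def)
  have bound: "norm (\<mu> k B) \<le> c" if "B \<in> borel_on \<Omega>" for k B
  proof -
    have "B \<subseteq> \<Omega>" using sets.sets_into_space[OF that] by (simp add: space_restrict_space)
    then show ?thesis
      using dom[OF that, of k] pos_measures_mono[OF \<beta> that Omega_in_borel_on, of k] c[of k] by simp
  qed
  have "limitin (narrow_topology \<Omega>) (\<mu> \<circ> r) \<nu> sequentially"
    using \<nu> \<mu>v bound conv by (intro setwise_imp_narrow[where c = c]) (simp_all add: K_set_iff[OF \<alpha>])
  with r \<nu> show ?thesis by blast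
qed

section \<open>Closure points, strong convergence and the case distinction on the indices\<close>

lemma limitin_imp_in_closure_of:
  assumes "limitin X f l F" "F \<noteq> bot" "\<forall>\<^sub>F n in F. f n \<in> S"
  shows "l \<in> X closure_of S"
  unfolding in_closure_of
proof (intro conjI allI impI)
  show "l \<in> topspace X" using assms(1) by (rule limitin_topspace)
  fix T assume "l \<in> T \<and> openin X T"
  then have "\<forall>\<^sub>F n in F. f n \<in> T" using assms(1) by (simp add: limitin_def)
  with assms(3) have "\<forall>\<^sub>F n in F. f n \<in> S \<and> f n \<in> T" by (rule eventually_conj)
  then show "\<exists>y. y \<in> S \<and> y \<in> T" using assms(2) eventually_happens' by blast
qed

text \<open>The difference on a single Borel set is squeezed between 0 and its total variation on
  \<Omega>.\<close>

lemma converges_strongly_imp_setwise: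
  assumes "converges_strongly \<Omega> \<mu> \<nu>" and B: "B \<in> borel_on \<Omega>"
  shows "(\<lambda>n. \<mu> n B) \<longlonglongrightarrow> \<nu> B"
proof -
  have "B \<subseteq> \<Omega>" using sets.sets_into_space[OF B] by (simp add: space_restrict_space)
  then have le: "ennreal (norm (\<mu> n B - \<nu> B)) \<le> tv_norm \<Omega> (\<lambda>B. \<mu> n B - \<nu> B)" for n
    unfolding tv_norm_def by (rule norm_le_total_variation[OF B Omega_in_borel_on])
  have "(\<lambda>n. ennreal (norm (\<mu> n B - \<nu> B))) \<longlonglongrightarrow> 0"
    by (rule tendsto_sandwich[OF _ _ tendsto_const assms(1)[unfolded converges_strongly_def]])
      (simp_all add: le)
  then have "(\<lambda>n. norm (\<mu> n B - \<nu> B)) \<longlonglongrightarrow> 0"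
    unfolding ennreal_0[symmetric] by (subst (asm) tendsto_ennreal_iff) simp_all
  then show ?thesis by (simp add: tendsto_norm_zero_iff Lim_null[symmetric])
qed

theorem theorem4p4:
  fixes \<Omega> :: "(real ^ 'm) set"
    and \<alpha> :: "nat \<Rightarrow> (real ^ 'm) set \<Rightarrow> real"
    and \<alpha>lim :: "(real ^ 'm) set \<Rightarrow> real"
    and \<mu> :: "nat \<Rightarrow> (real ^ 'm) set \<Rightarrow> real ^ 'n"
  assumes "open \<Omega>"
    and "\<And>n. \<alpha> n \<in> pos_measures \<Omega>"
    and "\<alpha>lim \<in> vmeasures \<Omega>"
    and "converges_strongly \<Omega> \<alpha> \<alpha>lim"
    and "\<And>k. \<mu> k \<in> (\<Union>n. K_set \<Omega> (\<alpha> n))"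
  shows "\<exists>r \<nu>. strict_mono r \<and> \<nu> \<in> vmeasures \<Omega> \<and>
           limitin (narrow_topology \<Omega>) (\<mu> \<circ> r) \<nu> sequentially \<and>
           ((\<exists>i. \<nu> \<in> K_set \<Omega> (\<alpha> i)) \<or>
            (\<forall>j. \<nu> \<in> narrow_topology \<Omega> closure_of (\<Union>n\<in>{j..}. K_set \<Omega> (\<alpha> n))))"
proof -
  have "\<forall>k. \<exists>n. \<mu> k \<in> K_set \<Omega> (\<alpha> n)" using assms(5) by blast
  then obtain N where N: "\<And>k. \<mu> k \<in> K_set \<Omega> (\<alpha> (N k))" by (rule choice[THEN exE]) (rule that, erule spec)
  show ?thesis
  proof (cases "\<exists>i. infinite {k. N k = i}")
    case True
    then obtain i where "infinite {k. N k = i}" by blast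
    from infinite_enumerate[OF this] obtain s :: "nat \<Rightarrow> nat"
      where s: "strict_mono s" "\<forall>k. s k \<in> {k. N k = i}"
      by blast
    \<comment> \<open>Along \<open>s\<close> every term lies in the same \<open>K_set\<close>, so
      the constant sequence \<open>\<alpha> i\<close> serves both as the bounds and as their
      limit.\<close>
    have "\<exists>r \<nu>. strict_mono r \<and> \<nu> \<in> K_set \<Omega> (\<alpha> i) \<and>
        limitin (narrow_topology \<Omega>) ((\<mu> \<circ> s) \<circ> r) \<nu> sequentially"
    proof (rule K_set_narrow_subsequence)
      show "(\<mu> \<circ> s) k \<in> K_set \<Omega> (\<alpha> i)" for k using N[of "s k"] s(2) by simp
    qed (simp_all add: assms(2))
    then obtain r \<nu> where "strict_mono r" "\<nu> \<in> K_set \<Omega> (\<alpha> i)"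
      "limitin (narrow_topology \<Omega>) (\<mu> \<circ> (s \<circ> r)) \<nu> sequentially"
      by (auto simp: o_assoc)
    moreover from this s(1) have "strict_mono (s \<circ> r)" by (simp add: strict_mono_o)
    ultimately show ?thesis unfolding K_set_def by blast
  next
    case False
    \<comment> \<open>\<open>N\<close> need not be monotone; finiteness of all its fibres is what
      makes it tend to infinity.\<close>
    have "finite {k. N k < j}" for j
    proof -
      have "{k. N k < j} = (\<Union>i<j. {k. N k = i})" by auto
      with False show ?thesis by simp
    qed
    then have N_top: "filterlim N at_top sequentially"
      unfolding filterlim_at_top
      unfolding cofinite_eq_sequentially[symmetric]
      by (simp add: eventually_cofinite not_le)
    have lim: "(\<lambda>n. \<alpha> n B) \<longlonglongrightarrow> \<alpha>lim B" if "B \<in> borel_on \<Omega>" for B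
      by (rule converges_strongly_imp_setwise[OF assms(4) that])
    \<comment> \<open>The strong limit is only given as a signed measure; its positivity is
      inherited from the setwise limit.\<close>
    have \<alpha>lim: "\<alpha>lim \<in> pos_measures \<Omega>"
      unfolding pos_measures_def
    proof (intro CollectI conjI ballI assms(3))
      fix B assume "B \<in> borel_on \<Omega>"
      from lim[OF this] show "0 \<le> \<alpha>lim B"
        by (rule LIMSEQ_le_const) (use pos_measures_nonneg[OF assms(2)] in blast)
    qed
    have "(\<lambda>k. \<alpha> (N k) B) \<longlonglongrightarrow> \<alpha>lim B" if "B \<in> borel_on \<Omega>" for B
      by (rule filterlim_compose[OF lim[OF that] N_top])
    from K_set_narrow_subsequence[OF assms(2) \<alpha>lim this N]
    obtain r \<nu> where r: "strict_mono r" and \<nu>: "\<nu> \<in> K_set \<Omega> \<alpha>lim"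
      and conv: "limitin (narrow_topology \<Omega>) (\<mu> \<circ> r) \<nu> sequentially" by blast
    \<comment> \<open>For each \<open>j\<close> the indices \<open>N (r k)\<close> eventually exceed
      or equal \<open>j\<close>, so the subsequence eventually stays in the tail union and its limit
      lies in the closure.\<close>
    have "\<nu> \<in> narrow_topology \<Omega> closure_of (\<Union>n\<in>{j..}. K_set \<Omega> (\<alpha> n))" for j
    proof (rule limitin_imp_in_closure_of[OF conv])
      have "\<forall>\<^sub>F k in sequentially. j \<le> N (r k)"
        using filterlim_compose[OF N_top filterlim_subseq[OF r]] by (simp add: filterlim_at_top)
      then show "\<forall>\<^sub>F k in sequentially. (\<mu> \<circ> r) k \<in> (\<Union>n\<in>{j..}. K_set \<Omega> (\<alpha> n))"
        by (rule eventually_mono) (use N in auto)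
    qed simp
    with r \<nu> conv show ?thesis unfolding K_set_def by blast
  qed
qed

end
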